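(* Every right-c.e. quasi-metric space $(X,d,S)$ such that $d$ is (Smyth-)complete is an effective quasi-Polish space (with the effective topology given by the basis of balls $B(s,r)$, $s\in S$, $r$ positive rational).
   Context: A quasi-metric on a set $X$ is $d:X\times X\to\mathbb{R}_{\ge0}$ with $d(x,z)\le d(x,y)+d(y,z)$ and $x=y$ iff $d(x,y)=d(y,x)=0$; $\hat d(x,y)=\max(d(x,y),d(y,x))$. A real is right-c.e. if it is $\inf_i q_i$ for a computable sequence of rationals. A right-c.e. quasi-metric space is $(X,d,S)$ with $S=(s_i)$ a $\hat d$-dense sequence with $d(s_i,s_j)$ uniformly right-c.e.; its effective topology has basis the balls $B(s_i,r)=\{x:d(s_i,x)<r\}$, $r>0$ rational. $d$ is (Smyth-)complete if every sequence $(x_n)$ that is Cauchy (for every $\varepsilon>0$ there is $N$ with $d(x_n,x_m)<\varepsilon$ for all $N\le n\le m$) converges in $\hat d$. Let $(W_e)$ enumerate c.e. sets; an effective topological space is a countably based $T_0$ space with a numbered basis $(B_i)$ such that $B_i\cap B_j=\bigcup_{k\in W_{f(i,j)}}B_k$ for a computable $f$; effective open sets are $\bigcup_{i\in W}B_i$, $W$ c.e. An effective topological space $X$ is an effective quasi-Polish space if it is empty or it is the image of $\mathbb{N}^{\mathbb{N}}$ under a map $f$ that is computable ($f^{-1}(B_i)$ uniformly effective open) and effectively open (there are uniformly effective open $U_\sigma\subseteq X$ with $f([\sigma])=U_\sigma$ for every cylinder $[\sigma]$). *)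

theory Defs
  imports "HOL-Analysis.Analysis" "HOL-Library.Nat_Bijection"
begin

text \<open>
  Programs denote unary partial functions on \<open>nat\<close>; several arguments are passed through
  \<open>prod_encode\<close>. The closure under primitive recursion and unbounded search makes the
  denoted functions exactly the (unary) partial recursive functions.
\<close>

datatype prog =
    PZero | PSucc | PFst | PSnd
  | PPair prog prog | PComp prog prog | PRec prog prog | PMu prog

primrec run :: "prog \<Rightarrow> nat \<Rightarrow> nat option" where
  "run PZero x = Some 0"
| "run PSucc x = Some (Suc x)"
| "run PFst x = Some (fst (prod_decode x))"
| "run PSnd x = Some (snd (prod_decode x))"
| "run (PPair f g) x =
     Option.bind (run f x) (\<lambda>a. Option.bind (run g x) (\<lambda>b. Some (prod_encode (a, b))))"
| "run (PComp f g) x = Option.bind (run g x) (run f)"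
| "run (PRec f g) x =
     (case prod_decode x of (a, n) \<Rightarrow>
        rec_nat (run f a)
          (\<lambda>m r. Option.bind r (\<lambda>y. run g (prod_encode (a, prod_encode (m, y))))) n)"
| "run (PMu f) x =
     (if \<exists>n. run f (prod_encode (x, n)) = Some 0 \<and>
             (\<forall>m<n. run f (prod_encode (x, m)) \<noteq> None)
      then Some (LEAST n. run f (prod_encode (x, n)) = Some 0)
      else None)"

primrec prog_encode :: "prog \<Rightarrow> nat" where
  "prog_encode PZero = 0"
| "prog_encode PSucc = 1"
| "prog_encode PFst = 2"
| "prog_encode PSnd = 3"
| "prog_encode (PPair f g) = 4 + 4 * prod_encode (prog_encode f, prog_encode g)"
| "prog_encode (PComp f g) = 5 + 4 * prod_encode (prog_encode f, prog_encode g)"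
| "prog_encode (PRec f g) = 6 + 4 * prod_encode (prog_encode f, prog_encode g)"
| "prog_encode (PMu f) = 7 + 4 * prog_encode f"

lemma inj_prog_encode: "inj prog_encode"
proof (rule injI)
  fix p q assume "prog_encode p = prog_encode q"
  then show "p = q"
  proof (induction p arbitrary: q)
    case PZero then show ?case by (cases q) auto
  next
    case PSucc then show ?case by (cases q) auto
  next
    case PFst then show ?case by (cases q) (auto; presburger)+
  next
    case PSnd then show ?case by (cases q) (auto; presburger)+
  next
    case (PPair p1 p2) then show ?case by (cases q) (auto simp: prod_encode_eq; presburger)+
  next
    case (PComp p1 p2) then show ?case by (cases q) (auto simp: prod_encode_eq; presburger)+
  next
    case (PRec p1 p2) then show ?case by (cases q) (auto simp: prod_encode_eq; presburger)+
  next
    case (PMu p) then show ?case by (cases q) (auto simp: prod_encode_eq; presburger)+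
  qed
qed

lemma surj_prog_encode: "surj prog_encode"
proof -
  have "\<exists>p. prog_encode p = n" for n
  proof (induction n rule: less_induct)
    case (less n)
    show ?case
    proof (cases "n < 4")
      case True
      then consider "n = 0" | "n = 1" | "n = 2" | "n = 3" by linarith
      then show ?thesis
        by cases (metis prog_encode.simps)+
    next
      case False
      define k where "k = (n - 4) div 4"
      obtain a b where ab: "k = prod_encode (a, b)" by (metis prod_decode_inverse surj_pair)
      have "a \<le> k" "b \<le> k" using ab le_prod_encode_1 le_prod_encode_2 by auto
      moreover have "k < n" using False unfolding k_def by auto
      ultimately obtain p q r where
        pqr: "prog_encode p = a" "prog_encode q = b" "prog_encode r = k"
        using less.IH by (meson le_less_trans)
      have "n = 4 + 4 * k \<or> n = 5 + 4 * k \<or> n = 6 + 4 * k \<or> n = 7 + 4 * k"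
        using False unfolding k_def by presburger
      then show ?thesis using pqr ab by (metis prog_encode.simps(5-8))
    qed
  qed
  then show ?thesis by (metis surjI)
qed

lemma bij_prog_encode: "bij prog_encode"
  using inj_prog_encode surj_prog_encode by (simp add: bij_def)

definition computable :: "(nat \<Rightarrow> nat) \<Rightarrow> bool" where
  "computable f \<longleftrightarrow> (\<exists>p. \<forall>x. run p x = Some (f x))"

definition computable2 :: "(nat \<Rightarrow> nat \<Rightarrow> nat) \<Rightarrow> bool" where
  "computable2 f \<longleftrightarrow> (\<exists>p. \<forall>x y. run p (prod_encode (x, y)) = Some (f x y))"

definition computable3 :: "(nat \<Rightarrow> nat \<Rightarrow> nat \<Rightarrow> nat) \<Rightarrow> bool" where
  "computable3 f \<longleftrightarrow>
     (\<exists>p. \<forall>x y z. run p (prod_encode (x, prod_encode (y, z))) = Some (f x y z))"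

definition W :: "nat \<Rightarrow> nat set" where
  "W e = dom (run (inv prog_encode e))"

definition rat_num :: "nat \<Rightarrow> rat" where
  "rat_num n = (case prod_decode n of (a, b) \<Rightarrow> of_int (int_decode a) / of_nat (Suc b))"

definition pos_rat_num :: "nat \<Rightarrow> rat" where
  "pos_rat_num n = (case prod_decode n of (a, b) \<Rightarrow> of_nat (Suc a) / of_nat (Suc b))"

text \<open>
  The boundedness clause is needed because the real infimum of a set that is not bounded below
  is unspecified.
\<close>

definition uniformly_right_ce :: "(nat \<Rightarrow> nat \<Rightarrow> real) \<Rightarrow> bool" where
  "uniformly_right_ce x \<longleftrightarrow>
     (\<exists>q. computable3 q \<and>
        (\<forall>i j. bdd_below (range (\<lambda>k. real_of_rat (rat_num (q i j k)))) \<and>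
               x i j = (INF k. real_of_rat (rat_num (q i j k)))))"

definition effective_topological_space :: "'a topology \<Rightarrow> (nat \<Rightarrow> 'a set) \<Rightarrow> bool" where
  "effective_topological_space T B \<longleftrightarrow>
     t0_space T \<and>
     openin T = arbitrary union_of (\<lambda>U. U \<in> range B) \<and>
     (\<exists>f. computable2 f \<and> (\<forall>i j. B i \<inter> B j = (\<Union>k\<in>W (f i j). B k)))"

definition uniformly_effective_open :: "(nat \<Rightarrow> 'a set) \<Rightarrow> (nat \<Rightarrow> 'a set) \<Rightarrow> bool" where
  "uniformly_effective_open B U \<longleftrightarrow>
     (\<exists>g. computable g \<and> (\<forall>n. U n = (\<Union>i\<in>W (g n). B i)))"

definition cylinder :: "nat list \<Rightarrow> (nat \<Rightarrow> nat) set" where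
  "cylinder \<sigma> = {p. \<forall>i<length \<sigma>. p i = \<sigma> ! i}"

definition baire_basis :: "nat \<Rightarrow> (nat \<Rightarrow> nat) set" where
  "baire_basis n = cylinder (list_decode n)"

definition computable_from_baire :: "(nat \<Rightarrow> 'a set) \<Rightarrow> ((nat \<Rightarrow> nat) \<Rightarrow> 'a) \<Rightarrow> bool" where
  "computable_from_baire B f \<longleftrightarrow> uniformly_effective_open baire_basis (\<lambda>i. f -` B i)"

definition effectively_open_from_baire ::
  "(nat \<Rightarrow> 'a set) \<Rightarrow> ((nat \<Rightarrow> nat) \<Rightarrow> 'a) \<Rightarrow> bool" where
  "effectively_open_from_baire B f \<longleftrightarrow>
     (\<exists>U. uniformly_effective_open B U \<and> (\<forall>\<sigma>. f ` cylinder \<sigma> = U (list_encode \<sigma>)))"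

definition effective_quasi_Polish :: "'a topology \<Rightarrow> (nat \<Rightarrow> 'a set) \<Rightarrow> bool" where
  "effective_quasi_Polish T B \<longleftrightarrow>
     effective_topological_space T B \<and>
     (topspace T = {} \<or>
      (\<exists>f :: (nat \<Rightarrow> nat) \<Rightarrow> 'a.
         range f = topspace T \<and> computable_from_baire B f \<and> effectively_open_from_baire B f))"

definition quasi_metric_on :: "'a set \<Rightarrow> ('a \<Rightarrow> 'a \<Rightarrow> real) \<Rightarrow> bool" where
  "quasi_metric_on X d \<longleftrightarrow>
     (\<forall>x\<in>X. \<forall>y\<in>X. 0 \<le> d x y) \<and>
     (\<forall>x\<in>X. \<forall>y\<in>X. \<forall>z\<in>X. d x z \<le> d x y + d y z) \<and>
     (\<forall>x\<in>X. \<forall>y\<in>X. x = y \<longleftrightarrow> d x y = 0 \<and> d y x = 0)"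

definition sym_dist :: "('a \<Rightarrow> 'a \<Rightarrow> real) \<Rightarrow> 'a \<Rightarrow> 'a \<Rightarrow> real" where
  "sym_dist d x y = max (d x y) (d y x)"

definition right_ce_quasi_metric_space ::
  "'a set \<Rightarrow> ('a \<Rightarrow> 'a \<Rightarrow> real) \<Rightarrow> (nat \<Rightarrow> 'a) \<Rightarrow> bool" where
  "right_ce_quasi_metric_space X d s \<longleftrightarrow>
     quasi_metric_on X d \<and>
     range s \<subseteq> X \<and>
     (\<forall>x\<in>X. \<forall>\<epsilon>>0. \<exists>i. sym_dist d (s i) x < \<epsilon>) \<and>
     uniformly_right_ce (\<lambda>i j. d (s i) (s j))"

definition qm_cauchy :: "('a \<Rightarrow> 'a \<Rightarrow> real) \<Rightarrow> (nat \<Rightarrow> 'a) \<Rightarrow> bool" where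
  "qm_cauchy d x \<longleftrightarrow> (\<forall>\<epsilon>>0. \<exists>N. \<forall>n m. N \<le> n \<and> n \<le> m \<longrightarrow> d (x n) (x m) < \<epsilon>)"

definition smyth_complete :: "'a set \<Rightarrow> ('a \<Rightarrow> 'a \<Rightarrow> real) \<Rightarrow> bool" where
  "smyth_complete X d \<longleftrightarrow>
     (\<forall>x. range x \<subseteq> X \<and> qm_cauchy d x \<longrightarrow>
        (\<exists>l\<in>X. (\<lambda>n. sym_dist d (x n) l) \<longlonglongrightarrow> 0))"

definition qm_ball :: "'a set \<Rightarrow> ('a \<Rightarrow> 'a \<Rightarrow> real) \<Rightarrow> 'a \<Rightarrow> real \<Rightarrow> 'a set" where
  "qm_ball X d c r = {x \<in> X. d c x < r}"

definition qm_basis ::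
  "'a set \<Rightarrow> ('a \<Rightarrow> 'a \<Rightarrow> real) \<Rightarrow> (nat \<Rightarrow> 'a) \<Rightarrow> nat \<Rightarrow> 'a set" where
  "qm_basis X d s n =
     (case prod_decode n of (i, j) \<Rightarrow> qm_ball X d (s i) (real_of_rat (pos_rat_num j)))"

text \<open>
  The topology is introduced as the one generated by the balls. That the balls form a basis of
  it, rather than just a subbasis, is part of \<open>effective_topological_space\<close>.
\<close>

definition qm_topology ::
  "'a set \<Rightarrow> ('a \<Rightarrow> 'a \<Rightarrow> real) \<Rightarrow> (nat \<Rightarrow> 'a) \<Rightarrow> 'a topology" where
  "qm_topology X d s = topology_generated_by (range (qm_basis X d s))"

end

theory Submission imports Defs begin

text \<open>
  A ball \<open>B(t,r')\<close> is formally inside \<open>B(s,r)\<close> if \<open>d(s,t) + r' < r\<close>. This relation is c.e. because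
  \<open>d\<close> is right-c.e. on the dense sequence, and every point of a ball lies in arbitrarily small balls
  formally inside it whose centres are close to the point in both directions. A point of Baire space
  is read as a sequence of balls, each formally inside its predecessor and of at most half its
  radius; the centres form a Cauchy sequence and Smyth completeness provides the limit. The points
  reached from a finite prefix are exactly those of the last ball of the prefix, so the limit map is
  effectively open and surjective, and the limit lies in \<open>B(s,r)\<close> iff some ball of the sequence is
  formally inside \<open>B(s,r)\<close>, so the map is computable.
\<close>

section \<open>Closure properties of computable functions\<close>

abbreviation pfst :: "nat \<Rightarrow> nat" where "pfst z \<equiv> fst (prod_decode z)"
abbreviation psnd :: "nat \<Rightarrow> nat" where "psnd z \<equiv> snd (prod_decode z)"

named_theorems computable_intros

definition decidable :: "(nat \<Rightarrow> bool) \<Rightarrow> bool" where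
  "decidable P \<longleftrightarrow> computable (\<lambda>x. of_bool (P x))"

lemma computable_cong:
  assumes "computable f" "\<And>x. f x = g x"
  shows "computable g"
  using assms by (metis ext)

lemma run_identity: "run (PPair PFst PSnd) x = Some x"
  by simp

lemma computable_id [computable_intros]: "computable (\<lambda>x. x)"
  unfolding computable_def using run_identity by blast

lemma computable_pair [computable_intros]:
  assumes "computable f" "computable g"
  shows "computable (\<lambda>x. prod_encode (f x, g x))"
proof -
  obtain p q where "\<forall>x. run p x = Some (f x)" "\<forall>x. run q x = Some (g x)"
    using assms unfolding computable_def by blast
  then have "\<forall>x. run (PPair p q) x = Some (prod_encode (f x, g x))" by simp
  then show ?thesis unfolding computable_def by blast
qed

lemma computable_comp:
  assumes "computable f" "computable g"
  shows "computable (\<lambda>x. f (g x))"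
proof -
  obtain p q where "\<forall>x. run p x = Some (f x)" "\<forall>x. run q x = Some (g x)"
    using assms unfolding computable_def by blast
  then have "\<forall>x. run (PComp p q) x = Some (f (g x))" by simp
  then show ?thesis unfolding computable_def by blast
qed

lemma computable_Suc [computable_intros]: "computable f \<Longrightarrow> computable (\<lambda>x. Suc (f x))"
  by (rule computable_comp[of Suc]) (auto simp: computable_def intro: exI[of _ PSucc])

lemma computable_pfst [computable_intros]: "computable f \<Longrightarrow> computable (\<lambda>x. pfst (f x))"
  by (rule computable_comp[of pfst]) (auto simp: computable_def intro: exI[of _ PFst])

lemma computable_psnd [computable_intros]: "computable f \<Longrightarrow> computable (\<lambda>x. psnd (f x))"
  by (rule computable_comp[of psnd]) (auto simp: computable_def intro: exI[of _ PSnd])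

lemma computable_const [computable_intros]: "computable (\<lambda>_. n)"
proof (induction n)
  case 0
  show ?case by (auto simp: computable_def intro: exI[of _ PZero])
qed (rule computable_Suc)

text \<open>Reading the arguments off a pair lets the introduction rules for unary functions apply
  to functions of two arguments.\<close>

lemma computable2_iff: "computable2 f \<longleftrightarrow> computable (\<lambda>z. f (pfst z) (psnd z))"
  unfolding computable2_def computable_def
  by (metis fst_conv prod.collapse prod_decode_inverse prod_encode_inverse snd_conv)

lemma computable3_iff:
  "computable3 f \<longleftrightarrow> computable (\<lambda>z. f (pfst z) (pfst (psnd z)) (psnd (psnd z)))"
  unfolding computable3_def computable_def
  by (metis fst_conv prod.collapse prod_decode_inverse prod_encode_inverse snd_conv)

lemma computable2_comp:
  assumes "computable2 h" "computable f" "computable g"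
  shows "computable (\<lambda>x. h (f x) (g x))"
  using computable_comp[OF assms(1)[unfolded computable2_iff] computable_pair[OF assms(2,3)]]
  by simp

lemma computable3_comp:
  assumes "computable3 h" "computable f" "computable g" "computable k"
  shows "computable (\<lambda>x. h (f x) (g x) (k x))"
  using computable_comp[OF assms(1)[unfolded computable3_iff]
      computable_pair[OF assms(2) computable_pair[OF assms(3,4)]]]
  by simp

text \<open>The source of the arithmetic below: \<open>PRec\<close> hands the parameter
  \<open>x\<close> to every step, so the step function \<open>h x\<close> may depend on it.\<close>

lemma computable_rec_nat:
  assumes "computable a" "computable3 h" "computable n"
  shows "computable (\<lambda>x. rec_nat (a x) (h x) (n x))"
proof -
  obtain p q where p: "\<And>x. run p x = Some (a x)"
    and q: "\<And>x y z. run q (prod_encode (x, prod_encode (y, z))) = Some (h x y z)"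
    using assms(1,2) unfolding computable_def computable3_def by blast
  have "run (PRec p q) (prod_encode (x, m)) = Some (rec_nat (a x) (h x) m)" for x m
    by (induction m) (auto simp: p q)
  then have "computable2 (\<lambda>x. rec_nat (a x) (h x))"
    unfolding computable2_def by blast
  then show ?thesis
    using computable2_comp[OF _ computable_id assms(3)] by blast
qed

lemma computable_add [computable_intros]:
  assumes "computable f" "computable g"
  shows "computable (\<lambda>x. f x + g x)"
proof -
  have "computable (\<lambda>x. rec_nat (f x) (\<lambda>_ r. Suc r) (g x))"
    by (intro computable_rec_nat computable_intros assms, unfold computable3_iff,
        intro computable_intros)
  moreover have "rec_nat a (\<lambda>_ r. Suc r) b = a + b" for a b
    by (induction b) auto
  ultimately show ?thesis by (rule computable_cong)
qed

lemma computable_mult [computable_intros]: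
  assumes "computable f" "computable g"
  shows "computable (\<lambda>x. f x * g x)"
proof -
  have "computable (\<lambda>x. rec_nat 0 (\<lambda>_ r. r + f x) (g x))"
    by (intro computable_rec_nat computable_intros assms, unfold computable3_iff,
        intro computable_intros computable_comp[OF assms(1)])
  moreover have "rec_nat 0 (\<lambda>_ r. r + a) b = a * b" for a b :: nat
    by (induction b) auto
  ultimately show ?thesis by (rule computable_cong)
qed

lemma computable_pred [computable_intros]:
  assumes "computable f"
  shows "computable (\<lambda>x. f x - 1)"
proof -
  \<comment> \<open>The step discards the previous value and returns the counter, which ends one
    below a positive \<open>f x\<close>.\<close>
  have "computable (\<lambda>x. rec_nat 0 (\<lambda>m _. m) (f x))"
    by (intro computable_rec_nat computable_intros assms, unfold computable3_iff,
        intro computable_intros)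
  moreover have "rec_nat 0 (\<lambda>m _. m) b = b - 1" for b :: nat
    by (cases b) auto
  ultimately show ?thesis by (rule computable_cong)
qed

lemma computable_diff [computable_intros]:
  assumes "computable f" "computable g"
  shows "computable (\<lambda>x. f x - g x)"
proof -
  have "computable (\<lambda>x. rec_nat (f x) (\<lambda>_ r. r - 1) (g x))"
    by (intro computable_rec_nat computable_intros assms, unfold computable3_iff,
        intro computable_intros)
  moreover have "rec_nat a (\<lambda>_ r. r - 1) b = a - b" for a b :: nat
    by (induction b) auto
  ultimately show ?thesis by (rule computable_cong)
qed

section \<open>Decidable predicates and case distinctions\<close>

lemma decidable_less [computable_intros]:
  assumes "computable f" "computable g"
  shows "decidable (\<lambda>x. f x < g x)"
proof -
  \<comment> \<open>By truncated subtraction, \<open>Suc a - b\<close> vanishes exactly when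
    \<open>a < b\<close>.\<close>
  have "computable (\<lambda>x. 1 - (Suc (f x) - g x))"
    by (intro computable_intros assms)
  moreover have "1 - (Suc a - b) = of_bool (a < b)" for a b :: nat
    by auto
  ultimately show ?thesis unfolding decidable_def by (rule computable_cong)
qed

lemma decidable_conj [computable_intros]:
  assumes "decidable P" "decidable Q"
  shows "decidable (\<lambda>x. P x \<and> Q x)"
  using computable_mult[OF assms[unfolded decidable_def]]
  by (simp add: decidable_def of_bool_conj)

lemma decidable_not [computable_intros]:
  assumes "decidable P"
  shows "decidable (\<lambda>x. \<not> P x)"
proof -
  have "computable (\<lambda>x. 1 - of_bool (P x))"
    by (intro computable_intros assms[unfolded decidable_def])
  moreover have "1 - of_bool p = (of_bool (\<not> p) :: nat)" for p by simp
  ultimately show ?thesis unfolding decidable_def by (rule computable_cong)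
qed

lemma decidable_le [computable_intros]:
  assumes "computable f" "computable g"
  shows "decidable (\<lambda>x. f x \<le> g x)"
  using decidable_not[OF decidable_less[OF assms(2,1)]] by (simp add: not_less)

lemma decidable_eq [computable_intros]:
  assumes "computable f" "computable g"
  shows "decidable (\<lambda>x. f x = g x)"
  using decidable_conj[OF decidable_le[OF assms] decidable_le[OF assms(2,1)]]
  by (simp add: order_eq_iff)

lemma computable_if [computable_intros]:
  assumes "decidable P" "computable f" "computable g"
  shows "computable (\<lambda>x. if P x then f x else g x)"
proof -
  have "computable (\<lambda>x. of_bool (P x) * f x + (1 - of_bool (P x)) * g x)"
    by (intro computable_intros assms assms(1)[unfolded decidable_def])
  moreover have "of_bool p * a + (1 - of_bool p) * b = (if p then a else b)" for p and a b :: nat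
    by simp
  ultimately show ?thesis by (rule computable_cong)
qed

lemma decidable_if [computable_intros]:
  assumes "decidable P" "decidable Q" "decidable R"
  shows "decidable (\<lambda>x. if P x then Q x else R x)"
proof -
  have "computable (\<lambda>x. if P x then of_bool (Q x) else of_bool (R x))"
    by (intro computable_intros assms assms(2,3)[unfolded decidable_def])
  then show ?thesis unfolding decidable_def by (simp add: if_distrib)
qed

text \<open>One recursion carries quotient and remainder together: each step flips the parity and
  increases the quotient on a carry.\<close>

lemma computable_half_parity:
  "computable (\<lambda>x. prod_encode (x div 2, x mod 2))"
proof -
  let ?h = "\<lambda>r. if psnd r = 0 then prod_encode (pfst r, 1) else prod_encode (Suc (pfst r), 0)"
  have "computable (\<lambda>x. rec_nat (prod_encode (0, 0)) (\<lambda>_. ?h) x)"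
    by (intro computable_rec_nat computable_intros, unfold computable3_iff,
        intro computable_intros)
  moreover have "rec_nat (prod_encode (0, 0)) (\<lambda>_. ?h) x = prod_encode (x div 2, x mod 2)" for x
    by (induction x) (auto, presburger+)
  ultimately show ?thesis by (rule computable_cong)
qed

lemma computable_half [computable_intros]: "computable f \<Longrightarrow> computable (\<lambda>x. f x div 2)"
  using computable_pfst[OF computable_comp[OF computable_half_parity]] by simp

lemma decidable_even [computable_intros]:
  assumes "computable f"
  shows "decidable (\<lambda>x. even (f x))"
proof -
  have "computable (\<lambda>x. f x mod 2)"
    using computable_psnd[OF computable_comp[OF computable_half_parity assms]] by simp
  then have "decidable (\<lambda>x. f x mod 2 = 0)" by (intro computable_intros)
  then show ?thesis by (simp add: even_iff_mod_2_eq_zero)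
qed

lemma computable_foldl:
  assumes "computable2 h"
  shows "computable (\<lambda>x. foldl h a (list_decode x))"
proof -
  text \<open>Iterate on pairs of remaining input and accumulator; the code of a list bounds its
    length, and iterating on an exhausted input does nothing.\<close>
  let ?g = "\<lambda>r. if pfst r = 0 then r
    else prod_encode (psnd (pfst r - 1), h (psnd r) (pfst (pfst r - 1)))"
  have comp: "computable (\<lambda>x. rec_nat (prod_encode (x, a)) (\<lambda>_. ?g) x)"
    by (intro computable_rec_nat computable_intros, unfold computable3_iff,
        intro computable_intros computable2_comp[OF assms])
  \<comment> \<open>\<open>rec_nat\<close> applies its step on the outside. Moving one application
    inside lets the induction consume the head of the list first.\<close>
  have it: "rec_nat r (\<lambda>_. ?g) (Suc n) = rec_nat (?g r) (\<lambda>_. ?g) n" for r n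
    by (induction n arbitrary: r) simp_all
  have iterate: "length xs \<le> n \<Longrightarrow>
      rec_nat (prod_encode (list_encode xs, b)) (\<lambda>_. ?g) n = prod_encode (0, foldl h b xs)"
    for xs n b
  proof (induction n arbitrary: xs b)
    case (Suc n)
    show ?case
    proof (cases xs)
      case Nil
      with Suc.IH[of "[]" b] show ?thesis unfolding it by simp
    next
      case (Cons y ys)
      with Suc.IH[of ys "h b y"] Suc.prems show ?thesis unfolding it by simp
    qed
  qed simp
  have "length xs \<le> list_encode xs" for xs
  proof (induction xs)
    case (Cons y ys)
    then show ?case using le_prod_encode_2[of "list_encode ys" y] by simp
  qed simp
  from iterate[OF this, of "list_decode _"]
  have "rec_nat (prod_encode (x, a)) (\<lambda>_. ?g) x = prod_encode (0, foldl h a (list_decode x))" for x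
    by simp
  then have "psnd (rec_nat (prod_encode (x, a)) (\<lambda>_. ?g) x) = foldl h a (list_decode x)" for x
    by (simp only: prod_encode_inverse snd_conv)
  then show ?thesis
    by (rule computable_cong[OF computable_psnd[OF comp]])
qed

section \<open>Uniform families of c.e. sets\<close>

primrec const_prog :: "nat \<Rightarrow> prog" where
  "const_prog 0 = PZero"
| "const_prog (Suc n) = PComp PSucc (const_prog n)"

lemma run_const_prog: "run (const_prog n) x = Some n"
  by (induction n) auto

lemma computable_encode_const_prog: "computable (\<lambda>n. prog_encode (const_prog n))"
proof -
  \<comment> \<open>Here \<open>0\<close> is the code of \<open>PZero\<close>, \<open>1\<close> that
    of \<open>PSucc\<close>, and \<open>5 + 4 * prod_encode (_, _)\<close> codes a
    composition.\<close>
  have "computable (\<lambda>x. rec_nat 0 (\<lambda>_ r. 5 + 4 * prod_encode (1, r)) x)"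
    by (intro computable_rec_nat computable_intros, unfold computable3_iff,
        intro computable_intros)
  moreover have "rec_nat 0 (\<lambda>_ r. 5 + 4 * prod_encode (1, r)) x = prog_encode (const_prog x)" for x
    by (induction x) auto
  ultimately show ?thesis by (rule computable_cong)
qed

text \<open>An instance of the s-m-n theorem: the parameter is hard-wired into an unbounded search.\<close>

lemma uniformly_ce_projection:
  assumes "decidable (\<lambda>z. R (pfst z) (pfst (psnd z)) (psnd (psnd z)))"
  shows "\<exists>g. computable g \<and> (\<forall>e. W (g e) = {x. \<exists>n. R e x n})"
proof -
  \<comment> \<open>\<open>PMu\<close> looks for the value \<open>0\<close>, hence the complement of
    the characteristic function. As this function is total, the search halts iff some
    \<open>n\<close> satisfies \<open>R\<close>.\<close>
  have "computable (\<lambda>z. 1 - of_bool (R (pfst z) (pfst (psnd z)) (psnd (psnd z))))"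
    by (intro computable_intros assms[unfolded decidable_def])
  then obtain p where
    p: "\<And>z. run p z = Some (1 - of_bool (R (pfst z) (pfst (psnd z)) (psnd (psnd z))))"
    unfolding computable_def by blast
  let ?id = "PPair PFst PSnd"
  \<comment> \<open>On input \<open>x\<close> and trial \<open>n\<close>, \<open>PMu\<close> passes
    \<open>prod_encode (x, n)\<close>; pairing it with the constant \<open>e\<close> yields the
    triple that \<open>p\<close> expects.\<close>
  define search where "search e = PMu (PComp p (PPair (const_prog e) ?id))" for e
  have "run (search e) x \<noteq> None \<longleftrightarrow> (\<exists>n. R e x n)" for e x
    by (simp add: search_def p run_const_prog)
  then have "W (prog_encode (search e)) = {x. \<exists>n. R e x n}" for e
    unfolding W_def inv_f_f[OF inj_prog_encode] dom_def by simp
  \<comment> \<open>Only the pair containing \<open>const_prog _\<close> is unfolded: the codes of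
    the fixed subprograms stay constants, and \<open>e\<close> enters through
    \<open>const_prog e\<close> alone.\<close>
  moreover have "computable (\<lambda>e. prog_encode (search e))"
    unfolding search_def prog_encode.simps(6,8) prog_encode.simps(5)[of "const_prog _"]
    by (intro computable_intros computable_encode_const_prog)
  ultimately show ?thesis by blast
qed

section \<open>Comparison of coded rationals\<close>

lemma pos_rat_num_alt: "pos_rat_num n = of_nat (Suc (pfst n)) / of_nat (Suc (psnd n))"
  by (simp add: pos_rat_num_def case_prod_beta)

lemma pos_rat_num_pos: "0 < pos_rat_num n"
  unfolding pos_rat_num_alt
  by (intro divide_pos_pos) (simp_all only: of_nat_0_less_iff zero_less_Suc)

lemma fraction_add_less_iff:
  fixes a b c x y z :: "'a::linordered_field"
  assumes "0 < x" "0 < y" "0 < z"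
  shows "a / x + b / y < c / z \<longleftrightarrow> a * y * z + b * x * z < c * x * y"
  using assms by (simp add: add_frac_eq divide_less_eq less_divide_eq field_simps)

text \<open>Clearing the positive denominators leaves an inequality of integers. Only the numerator
  of \<open>rat_num\<close> can be negative; the parity of its code reveals the sign, and in the odd
  case that term moves to the other side, so the test stays within the natural numbers.\<close>

lemma decidable_rat_add_less [computable_intros]:
  assumes "computable u" "computable v" "computable w"
  shows "decidable (\<lambda>x. rat_num (u x) + pos_rat_num (v x) < pos_rat_num (w x))"
proof -
  let ?test = "\<lambda>u v w. if even (pfst u)
    then (pfst u div 2) * Suc (psnd v) * Suc (psnd w) + Suc (pfst v) * Suc (psnd u) * Suc (psnd w)
      < Suc (pfst w) * Suc (psnd u) * Suc (psnd v)
    else Suc (pfst v) * Suc (psnd u) * Suc (psnd w)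
      < Suc (pfst w) * Suc (psnd u) * Suc (psnd v)
        + Suc (pfst u div 2) * Suc (psnd v) * Suc (psnd w)"
  have "?test u v w \<longleftrightarrow> rat_num u + pos_rat_num v < pos_rat_num w" for u v w
  proof -
    have dec: "of_int (int_decode a) =
        (if even a then of_nat (a div 2) else - of_nat (Suc (a div 2)) :: rat)"
      for a
      by (simp add: int_decode_def sum_decode_def)
    have "rat_num u + pos_rat_num v < pos_rat_num w \<longleftrightarrow>
        of_int (int_decode (pfst u)) * of_nat (Suc (psnd v)) * of_nat (Suc (psnd w))
        + of_nat (Suc (pfst v)) * of_nat (Suc (psnd u)) * of_nat (Suc (psnd w))
        < (of_nat (Suc (pfst w)) * of_nat (Suc (psnd u)) * of_nat (Suc (psnd v)) :: rat)"
      unfolding rat_num_def pos_rat_num_alt case_prod_beta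
      by (intro fraction_add_less_iff) (simp_all only: of_nat_0_less_iff zero_less_Suc)
    also have "\<dots> \<longleftrightarrow> ?test u v w"
    proof (cases "even (pfst u)")
      case True
      then show ?thesis
        unfolding dec by (simp only: if_True flip: of_nat_mult of_nat_add) (simp only: of_nat_less_iff)
    next
      case False
      have minus: "- a * b * c + e < f \<longleftrightarrow> e < f + a * b * c" for a b c e f :: rat
        by auto
      from False show ?thesis
        unfolding dec
        by (simp only: if_False minus flip: of_nat_mult of_nat_add) (simp only: of_nat_less_iff)
    qed
    finally show ?thesis by simp
  qed
  then have "rat_num u + pos_rat_num v < pos_rat_num w \<longleftrightarrow> ?test u v w" for u v w by blast
  then show ?thesis
    by (simp only:) (intro computable_intros assms)
qed

lemma decidable_rat_half_le [computable_intros]: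
  assumes "computable v" "computable w"
  shows "decidable (\<lambda>x. 2 * pos_rat_num (v x) \<le> pos_rat_num (w x))"
proof -
  have "2 * pos_rat_num v \<le> pos_rat_num w \<longleftrightarrow>
      2 * Suc (pfst v) * Suc (psnd w) \<le> Suc (pfst w) * Suc (psnd v)" for v w
  proof -
    have *: "2 * (a / b) \<le> c / e \<longleftrightarrow> 2 * a * e \<le> c * b" if "0 < b" "0 < e" for a b c e :: rat
      using that by (simp add: field_simps)
    have "2 * pos_rat_num v \<le> pos_rat_num w \<longleftrightarrow>
        2 * of_nat (Suc (pfst v)) * of_nat (Suc (psnd w))
        \<le> (of_nat (Suc (pfst w)) * of_nat (Suc (psnd v)) :: rat)"
      unfolding pos_rat_num_alt by (intro *) (simp_all only: of_nat_0_less_iff zero_less_Suc)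
    also have "\<dots> \<longleftrightarrow> of_nat (2 * Suc (pfst v) * Suc (psnd w))
        \<le> (of_nat (Suc (pfst w) * Suc (psnd v)) :: rat)"
      by (simp only: of_nat_mult of_nat_numeral)
    finally show ?thesis by (simp only: of_nat_le_iff)
  qed
  then show ?thesis
    by (simp only:) (intro computable_intros assms)
qed

section \<open>Effective refinement of balls\<close>

text \<open>\<open>q\<close> is a parameter so that the certificates for upper bounds on distances
  can be named in the definitions below.\<close>

locale complete_right_ce =
  fixes X :: "'a set" and d :: "'a \<Rightarrow> 'a \<Rightarrow> real" and s :: "nat \<Rightarrow> 'a"
    and q :: "nat \<Rightarrow> nat \<Rightarrow> nat \<Rightarrow> nat"
  assumes quasi_metric: "quasi_metric_on X d"
    and range_s: "range s \<subseteq> X"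
    and dense: "\<And>x \<epsilon>. x \<in> X \<Longrightarrow> 0 < \<epsilon> \<Longrightarrow> \<exists>i. sym_dist d (s i) x < \<epsilon>"
    and computable_q: "computable3 q"
    and bdd_below_q: "\<And>i j. bdd_below (range (\<lambda>k. real_of_rat (rat_num (q i j k))))"
    and d_eq_INF: "\<And>i j. d (s i) (s j) = (INF k. real_of_rat (rat_num (q i j k)))"
    and complete: "smyth_complete X d"
begin

abbreviation ball :: "nat \<Rightarrow> 'a set" where "ball \<equiv> qm_basis X d s"

definition centre :: "nat \<Rightarrow> 'a" where "centre b = s (pfst b)"

definition radius :: "nat \<Rightarrow> real" where "radius b = real_of_rat (pos_rat_num (psnd b))"

lemma d_nonneg: "x \<in> X \<Longrightarrow> y \<in> X \<Longrightarrow> 0 \<le> d x y"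
  using quasi_metric by (simp add: quasi_metric_on_def)

lemma d_triangle: "x \<in> X \<Longrightarrow> y \<in> X \<Longrightarrow> z \<in> X \<Longrightarrow> d x z \<le> d x y + d y z"
  using quasi_metric by (simp add: quasi_metric_on_def)

lemma eq_iff_d_zero: "x \<in> X \<Longrightarrow> y \<in> X \<Longrightarrow> x = y \<longleftrightarrow> d x y = 0 \<and> d y x = 0"
  using quasi_metric unfolding quasi_metric_on_def
  by (elim conjE) (drule bspec, assumption, drule bspec)

lemma d_refl: "x \<in> X \<Longrightarrow> d x x = 0"
  using eq_iff_d_zero[of x x] by simp

lemma d_le_sym_dist: "d x y \<le> sym_dist d x y" "d y x \<le> sym_dist d x y"
  unfolding sym_dist_def by (rule max.cobounded1, rule max.cobounded2)

lemma centre_in [simp]: "centre b \<in> X"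
  unfolding centre_def using range_s by (rule range_subsetD)

lemma radius_pos: "0 < radius b"
  unfolding radius_def zero_less_of_rat_iff by (rule pos_rat_num_pos)

lemma mem_ball: "x \<in> ball b \<longleftrightarrow> x \<in> X \<and> d (centre b) x < radius b"
  by (simp add: qm_basis_def qm_ball_def centre_def radius_def case_prod_beta)

definition inside :: "nat \<Rightarrow> nat \<Rightarrow> bool" where
  "inside b c \<longleftrightarrow> d (centre b) (centre c) + radius c < radius b"

definition witness :: "nat \<Rightarrow> nat \<Rightarrow> nat \<Rightarrow> bool" where
  "witness b c k \<longleftrightarrow> rat_num (q (pfst b) (pfst c) k) + pos_rat_num (psnd c) < pos_rat_num (psnd b)"

text \<open>An infimum of a set bounded below is strictly below a number iff some member is. Thus a
  single index \<open>k\<close> certifies formal inclusion, which makes it c.e.\<close>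

lemma inside_iff_witness: "inside b c \<longleftrightarrow> (\<exists>k. witness b c k)"
proof -
  have "inside b c \<longleftrightarrow> (INF k. real_of_rat (rat_num (q (pfst b) (pfst c) k))) < radius b - radius c"
    unfolding inside_def centre_def d_eq_INF by auto
  also have "\<dots> \<longleftrightarrow> (\<exists>k. real_of_rat (rat_num (q (pfst b) (pfst c) k)) < radius b - radius c)"
    by (subst cINF_less_iff) (simp_all add: bdd_below_q)
  also have "\<dots> \<longleftrightarrow> (\<exists>k. witness b c k)"
    unfolding witness_def radius_def
    by (simp add: less_diff_eq of_rat_less flip: of_rat_add)
  finally show ?thesis .
qed

lemma decidable_witness [computable_intros]:
  assumes "computable f" "computable g" "computable h"
  shows "decidable (\<lambda>x. witness (f x) (g x) (h x))"
  unfolding witness_def by (intro computable_intros assms computable3_comp[OF computable_q])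

lemma ball_mono_inside:
  assumes "inside b c"
  shows "ball c \<subseteq> ball b"
proof
  fix x assume "x \<in> ball c"
  then have "x \<in> X" "d (centre c) x < radius c" by (simp_all add: mem_ball)
  with assms d_triangle[of "centre b" "centre c" x] show "x \<in> ball b"
    by (auto simp: inside_def mem_ball)
qed

text \<open>The radius is a unit fraction, for which density provides a centre. Both directions
  matter: \<open>d (centre c) x\<close> puts \<open>x\<close> into the ball, while
  \<open>d x (centre c)\<close> bounds the distance from other centres to the new one.\<close>

lemma small_ball_near:
  assumes "x \<in> X" "0 < \<epsilon>"
  obtains c where "sym_dist d (centre c) x < radius c" "radius c < \<epsilon>"
proof -
  obtain m where m: "inverse (real (Suc m)) < \<epsilon>"
    using reals_Archimedean[OF assms(2)] by blast
  have rad: "radius (prod_encode (i, prod_encode (0, m))) = inverse (real (Suc m))" for i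
    by (simp add: radius_def pos_rat_num_alt of_rat_divide of_rat_add inverse_eq_divide)
  have "0 < inverse (real (Suc m))" by simp
  then obtain i where "sym_dist d (s i) x < inverse (real (Suc m))"
    using dense[OF assms(1)] by blast
  with m rad[of i] that[of "prod_encode (i, prod_encode (0, m))"] show thesis
    by (simp add: centre_def)
qed

lemma small_ball_inside:
  assumes "x \<in> ball b" "0 < \<epsilon>"
  obtains c where "inside b c" "sym_dist d (centre c) x < radius c" "radius c < \<epsilon>"
proof -
  have x: "x \<in> X" "d (centre b) x < radius b" using assms by (simp_all add: mem_ball)
  \<comment> \<open>Half the slack of \<open>x\<close> in \<open>b\<close> suffices: the distance
    from \<open>x\<close> to the new centre and the new radius each use up less than
    \<delta>.\<close>
  define \<delta> where "\<delta> = min \<epsilon> ((radius b - d (centre b) x) / 2)"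
  have "0 < \<delta>" using x assms(2) by (simp add: \<delta>_def)
  then obtain c where c: "sym_dist d (centre c) x < radius c" "radius c < \<delta>"
    using small_ball_near[OF x(1)] by blast
  have "d (centre b) (centre c) \<le> d (centre b) x + sym_dist d (centre c) x"
    using d_triangle[of "centre b" x "centre c"] d_le_sym_dist(2)[of x "centre c"] x(1) by simp
  with c have "inside b c" by (simp add: inside_def \<delta>_def field_simps)
  with c that show thesis by (simp add: \<delta>_def)
qed

section \<open>Shrinking balls driven by an input sequence\<close>

definition halve :: "nat \<Rightarrow> nat" where
  "halve b = prod_encode (pfst b, prod_encode (pfst (psnd b), Suc (2 * psnd (psnd b))))"

lemma centre_halve [simp]: "centre (halve b) = centre b"
  by (simp add: halve_def centre_def)

text \<open>The denominator \<open>Suc k\<close> becomes \<open>Suc (Suc (2 * k))\<close>, which is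
  \<open>2 * Suc k\<close>.\<close>

lemma radius_halve [simp]: "radius (halve b) = radius b / 2"
proof -
  have "pos_rat_num (psnd (halve b)) = pos_rat_num (psnd b) / 2"
    by (simp add: halve_def pos_rat_num_alt field_simps)
  then show ?thesis unfolding radius_def by (simp only: of_rat_divide of_rat_numeral_eq)
qed

text \<open>An input is read as a proposed ball together with a witness that it lies inside the
  current one. Bad proposals are replaced by the concentric ball of half the radius, so that every
  input sequence describes a shrinking sequence of balls.\<close>

definition refine :: "nat \<Rightarrow> nat \<Rightarrow> nat" where
  "refine b n =
     (if witness b (pfst n) (psnd n) \<and> 2 * pos_rat_num (psnd (pfst n)) \<le> pos_rat_num (psnd b)
      then pfst n else halve b)"

text \<open>State \<open>0\<close> stands for the whole space and \<open>Suc b\<close> for the ball \<open>b\<close>.\<close>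

definition push :: "nat \<Rightarrow> nat \<Rightarrow> nat" where
  "push t n = (if t = 0 then Suc n else Suc (refine (t - 1) n))"

definition target :: "nat \<Rightarrow> 'a set" where
  "target t = (if t = 0 then X else ball (t - 1))"

lemma computable2_push: "computable2 push"
  unfolding computable2_iff push_def refine_def halve_def by (intro computable_intros)

lemma half_radius_le_iff:
  "2 * pos_rat_num (psnd c) \<le> pos_rat_num (psnd b) \<longleftrightarrow> 2 * radius c \<le> radius b"
proof -
  have "2 * radius c = real_of_rat (2 * pos_rat_num (psnd c))"
    by (simp add: radius_def of_rat_mult)
  then show ?thesis by (simp add: radius_def of_rat_less_eq)
qed

lemma refine_inside: "inside b (refine b n)"
proof (cases "refine b n = halve b")
  case True
  then show ?thesis using radius_pos[of b] by (simp add: inside_def d_refl)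
next
  case False
  then show ?thesis unfolding inside_iff_witness refine_def by (auto split: if_splits)
qed

lemma radius_refine: "radius (refine b n) \<le> radius b / 2"
proof (cases "refine b n = halve b")
  case False
  then show ?thesis
    unfolding refine_def half_radius_le_iff by (auto split: if_splits)
qed simp

text \<open>Serves to steer an input sequence towards a given \<open>x\<close>. In state
  \<open>0\<close> every proposal is accepted; otherwise the input packs a ball of less than half
  the radius with a witness, so that \<open>refine\<close> accepts it. \<open>push\<close> never
  returns \<open>0\<close>, so subtracting one recovers the ball.\<close>

lemma push_towards:
  assumes "x \<in> target t"
  shows "\<exists>n. sym_dist d (centre (push t n - 1)) x < radius (push t n - 1)"
proof (cases "t = 0")
  case True
  then show ?thesis
    using assms small_ball_near[of x 1] by (auto simp: target_def push_def)
next
  case False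
  then have "x \<in> ball (t - 1)" using assms by (simp add: target_def)
  moreover have "0 < radius (t - 1) / 2" by (simp add: radius_pos)
  ultimately obtain c where c: "inside (t - 1) c" "sym_dist d (centre c) x < radius c"
    "radius c < radius (t - 1) / 2"
    by (rule small_ball_inside)
  then obtain k where "witness (t - 1) c k" by (auto simp: inside_iff_witness)
  with c have "refine (t - 1) (prod_encode (c, k)) = c"
    by (simp add: refine_def half_radius_le_iff)
  with c False show ?thesis
    by (intro exI[of _ "prod_encode (c, k)"]) (simp add: push_def)
qed

lemma ball_push_subset: "ball (push t n - 1) \<subseteq> target t"
  using ball_mono_inside[OF refine_inside, of "t - 1" n]
  by (auto simp: push_def target_def mem_ball)

text \<open>The balls on the right are those that one more input can produce, a c.e. set uniformly
  in \<open>t\<close>. Hence all targets, including the whole space for state \<open>0\<close>, are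
  uniformly effective open.\<close>

lemma target_eq_Union_push: "target t = (\<Union>b\<in>{b. \<exists>n. Suc b = push t n}. ball b)"
proof (intro equalityI subsetI)
  fix x assume x: "x \<in> target t"
  then obtain n where "sym_dist d (centre (push t n - 1)) x < radius (push t n - 1)"
    using push_towards by blast
  moreover have "x \<in> X" using x by (auto simp: target_def mem_ball split: if_splits)
  ultimately have "x \<in> ball (push t n - 1)"
    using d_le_sym_dist(1)[of "centre (push t n - 1)" x] by (simp add: mem_ball)
  moreover have "Suc (push t n - 1) = push t n" by (simp add: push_def)
  ultimately show "x \<in> (\<Union>b\<in>{b. \<exists>n. Suc b = push t n}. ball b)" by blast
next
  fix x assume "x \<in> (\<Union>b\<in>{b. \<exists>n. Suc b = push t n}. ball b)"
  then obtain b n where "x \<in> ball b" "Suc b = push t n" by blast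
  with ball_push_subset[of t n] show "x \<in> target t" by (metis diff_Suc_1 subsetD)
qed

section \<open>The limit map on Baire space\<close>

definition trace :: "(nat \<Rightarrow> nat) \<Rightarrow> nat \<Rightarrow> nat" where
  "trace p n = foldl push 0 (map p [0..<n])"

text \<open>The state before the first input is not a ball, so the ball numbered \<open>n\<close> is
  determined by the first \<open>Suc n\<close> inputs.\<close>

definition code :: "(nat \<Rightarrow> nat) \<Rightarrow> nat \<Rightarrow> nat" where
  "code p n = trace p (Suc n) - 1"

lemma trace_Suc: "trace p (Suc n) = push (trace p n) (p n)"
  by (simp add: trace_def)

lemma Suc_code: "Suc (code p n) = trace p (Suc n)"
  by (simp add: code_def trace_Suc push_def)

lemma code_Suc: "code p (Suc n) = refine (code p n) (p (Suc n))"
proof -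
  have "Suc (code p (Suc n)) = push (Suc (code p n)) (p (Suc n))"
    by (simp only: Suc_code trace_Suc)
  then show ?thesis by (simp add: push_def)
qed

lemma trace_cylinder:
  assumes "p \<in> cylinder \<sigma>"
  shows "trace p (length \<sigma>) = foldl push 0 \<sigma>"
proof -
  have "map p [0..<length \<sigma>] = \<sigma>"
    using assms by (intro nth_equalityI) (auto simp: cylinder_def)
  then show ?thesis by (simp add: trace_def)
qed

lemma radius_code_le: "radius (code p n) \<le> radius (code p 0) / 2 ^ n"
proof (induction n)
  case (Suc n)
  have "radius (code p (Suc n)) \<le> radius (code p n) / 2"
    unfolding code_Suc by (rule radius_refine)
  also have "\<dots> \<le> radius (code p 0) / 2 ^ n / 2"
    using Suc by (rule divide_right_mono) simp
  finally show ?case by (simp add: mult.commute)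
qed simp

lemma radius_code_tendsto: "(\<lambda>n. radius (code p n)) \<longlonglongrightarrow> 0"
proof (rule tendsto_sandwich)
  show "\<forall>\<^sub>F n in sequentially. 0 \<le> radius (code p n)"
    using radius_pos by (simp add: less_imp_le)
  show "\<forall>\<^sub>F n in sequentially. radius (code p n) \<le> radius (code p 0) / 2 ^ n"
    using radius_code_le by simp
  show "(\<lambda>n. radius (code p 0) / 2 ^ n) \<longlonglongrightarrow> 0"
    using tendsto_mult_right_zero[OF LIMSEQ_power_zero[of "1 / 2 :: real"], of "radius (code p 0)"]
    by (simp add: power_one_over)
qed simp

text \<open>Consecutive formal inclusions add up by the triangle inequality; the case
  \<open>n = m\<close> makes the inequality weak.\<close>

lemma code_le:
  assumes "n \<le> m"
  shows "d (centre (code p n)) (centre (code p m)) + radius (code p m) \<le> radius (code p n)"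
  using assms
proof (induction m rule: dec_induct)
  case base
  show ?case by (simp add: d_refl)
next
  case (step m)
  have "inside (code p m) (code p (Suc m))" by (simp add: code_Suc refine_inside)
  then show ?case
    using step.IH d_triangle[of "centre (code p n)" "centre (code p m)" "centre (code p (Suc m))"]
    by (simp add: inside_def)
qed

lemma code_converges: "\<exists>l\<in>X. (\<lambda>n. sym_dist d (centre (code p n)) l) \<longlonglongrightarrow> 0"
proof -
  have "qm_cauchy d (\<lambda>n. centre (code p n))"
    unfolding qm_cauchy_def
  proof (intro allI impI)
    fix \<epsilon> :: real assume "0 < \<epsilon>"
    then obtain N where N: "\<And>n. N \<le> n \<Longrightarrow> radius (code p n) < \<epsilon>"
      using order_tendstoD(2)[OF radius_code_tendsto] unfolding eventually_sequentially by blast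
    \<comment> \<open>The Cauchy condition concerns forward distances only, and
      \<open>code_le\<close> bounds these by the radius of the earlier ball.\<close>
    have "d (centre (code p n)) (centre (code p m)) < \<epsilon>" if "N \<le> n" "n \<le> m" for n m
      using code_le[OF that(2), of p] N[OF that(1)] radius_pos[of "code p m"] by linarith
    then show "\<exists>N. \<forall>n m. N \<le> n \<and> n \<le> m \<longrightarrow> d (centre (code p n)) (centre (code p m)) < \<epsilon>"
      by blast
  qed
  moreover have "range (\<lambda>n. centre (code p n)) \<subseteq> X" by auto
  ultimately show ?thesis
    using complete[unfolded smyth_complete_def, rule_format] by blast
qed

text \<open>The triangle inequality through \<open>c n\<close> uses one distance into
  \<open>c n\<close> and one out of it. Convergence in \<open>sym_dist\<close> controls both, so
  \<open>d x y\<close> and \<open>d y x\<close> vanish.\<close>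

lemma sym_limit_unique:
  assumes "x \<in> X" "y \<in> X" "range c \<subseteq> X"
    and "(\<lambda>n. sym_dist d (c n) x) \<longlonglongrightarrow> 0" "(\<lambda>n. sym_dist d (c n) y) \<longlonglongrightarrow> 0"
  shows "x = y"
proof -
  have lim: "(\<lambda>n. sym_dist d (c n) x + sym_dist d (c n) y) \<longlonglongrightarrow> 0"
    using tendsto_add[OF assms(4,5)] by simp
  have "d x y \<le> sym_dist d (c n) x + sym_dist d (c n) y"
    "d y x \<le> sym_dist d (c n) x + sym_dist d (c n) y" for n
    using d_triangle[of x "c n" y] d_triangle[of y "c n" x] assms(1-3)
      d_le_sym_dist[of x "c n"] d_le_sym_dist[of "c n" x]
      d_le_sym_dist[of y "c n"] d_le_sym_dist[of "c n" y] by fastforce+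
  then have "d x y \<le> 0" "d y x \<le> 0"
    using LIMSEQ_le_const[OF lim] by blast+
  then show ?thesis
    using assms(1,2) d_nonneg eq_iff_d_zero by (meson order_antisym)
qed

definition limit :: "(nat \<Rightarrow> nat) \<Rightarrow> 'a" where
  "limit p = (SOME l. l \<in> X \<and> (\<lambda>n. sym_dist d (centre (code p n)) l) \<longlonglongrightarrow> 0)"

lemma limit_in [simp]: "limit p \<in> X"
  and limit_tendsto: "(\<lambda>n. sym_dist d (centre (code p n)) (limit p)) \<longlonglongrightarrow> 0"
  using someI_ex[of "\<lambda>l. l \<in> X \<and> (\<lambda>n. sym_dist d (centre (code p n)) l) \<longlonglongrightarrow> 0"]
    code_converges[of p] unfolding limit_def by blast+

lemma limit_eqI:
  "x \<in> X \<Longrightarrow> (\<lambda>n. sym_dist d (centre (code p n)) x) \<longlonglongrightarrow> 0 \<Longrightarrow> limit p = x"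
  by (rule sym_limit_unique[OF limit_in _ _ limit_tendsto]) auto

text \<open>Passing to the limit loses strictness: the limit is only known to be within the closed
  radius of ball \<open>Suc n\<close>. The strict formal inclusion of that ball in ball
  \<open>n\<close> restores it.\<close>

lemma limit_in_ball: "limit p \<in> ball (code p n)"
proof -
  have "d (centre (code p (Suc n))) (limit p) \<le> radius (code p (Suc n))"
  proof (rule LIMSEQ_le_const)
    show "(\<lambda>m. radius (code p (Suc n)) + sym_dist d (centre (code p m)) (limit p))
        \<longlonglongrightarrow> radius (code p (Suc n))"
      using tendsto_add[OF tendsto_const limit_tendsto] by simp
    have "d (centre (code p (Suc n))) (limit p)
        \<le> radius (code p (Suc n)) + sym_dist d (centre (code p m)) (limit p)" if "Suc n \<le> m" for m
      using code_le[OF that, of p] radius_pos[of "code p m"]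
        d_le_sym_dist(1)[of "centre (code p m)" "limit p"]
        d_triangle[of "centre (code p (Suc n))" "centre (code p m)" "limit p"] by simp
    then show "\<exists>N. \<forall>m\<ge>N. d (centre (code p (Suc n))) (limit p)
        \<le> radius (code p (Suc n)) + sym_dist d (centre (code p m)) (limit p)" by blast
  qed
  moreover have "inside (code p n) (code p (Suc n))" by (simp add: code_Suc refine_inside)
  ultimately show ?thesis
    using d_triangle[of "centre (code p n)" "centre (code p (Suc n))" "limit p"]
    by (simp add: inside_def mem_ball)
qed

lemma limit_in_target: "limit p \<in> target (trace p n)"
proof (cases n)
  case 0
  then show ?thesis by (simp add: trace_def target_def)
next
  case (Suc m)
  then show ?thesis using limit_in_ball[of p m] by (simp add: target_def flip: Suc_code)
qed

text \<open>A limit stays in the target of every state passed, which gives one inclusion. For the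
  other, \<sigma> is continued by inputs that steer towards \<open>x\<close>: every new ball
  contains \<open>x\<close>, so the choice can be repeated forever, and the vanishing radii force
  the limit to be \<open>x\<close>.\<close>

lemma limit_image_cylinder: "limit ` cylinder \<sigma> = target (foldl push 0 \<sigma>)"
proof (intro equalityI subsetI)
  fix x assume "x \<in> limit ` cylinder \<sigma>"
  then show "x \<in> target (foldl push 0 \<sigma>)"
    using limit_in_target by (auto simp flip: trace_cylinder)
next
  fix x assume x: "x \<in> target (foldl push 0 \<sigma>)"
  then have "x \<in> X" by (auto simp: target_def mem_ball split: if_splits)
  obtain next_input where next_input: "\<And>t. x \<in> target t \<Longrightarrow>
      sym_dist d (centre (push t (next_input t) - 1)) x < radius (push t (next_input t) - 1)"
    using push_towards by metis
  define u where "u = rec_nat (foldl push 0 \<sigma>) (\<lambda>_ t. push t (next_input t))"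
  have u_Suc: "u (Suc n) = push (u n) (next_input (u n))" for n by (simp add: u_def)
  have u_target: "x \<in> target (u n)" for n
  proof (induction n)
    case (Suc n)
    have "x \<in> ball (u (Suc n) - 1)"
      using next_input[OF Suc] \<open>x \<in> X\<close> d_le_sym_dist(1)[of "centre (u (Suc n) - 1)" x]
      unfolding u_Suc mem_ball by linarith
    then show ?case by (simp add: target_def u_Suc push_def)
  qed (simp add: u_def x)
  define p where "p i = (if i < length \<sigma> then \<sigma> ! i else next_input (u (i - length \<sigma>)))" for i
  have p: "p \<in> cylinder \<sigma>" by (simp add: p_def cylinder_def)
  have trace: "trace p (n + length \<sigma>) = u n" for n
  proof (induction n)
    case 0
    show ?case using trace_cylinder[OF p] by (simp add: u_def)
  next
    case (Suc n)
    then show ?case by (simp add: trace_Suc u_Suc p_def)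
  qed
  \<comment> \<open>\<open>code\<close> reads one input more than \<open>trace\<close> at the same
    index, so this ball belongs to the state \<open>u (Suc n)\<close>.\<close>
  have near: "sym_dist d (centre (code p (n + length \<sigma>))) x < radius (code p (n + length \<sigma>))" for n
    using next_input[OF u_target[of n]] trace[of "Suc n"] by (simp add: code_def u_Suc)
  have "(\<lambda>n. sym_dist d (centre (code p (n + length \<sigma>))) x) \<longlonglongrightarrow> 0"
  proof (rule tendsto_sandwich)
    show "\<forall>\<^sub>F n in sequentially. 0 \<le> sym_dist d (centre (code p (n + length \<sigma>))) x"
      using \<open>x \<in> X\<close> by (simp add: sym_dist_def d_nonneg le_max_iff_disj)
    show "\<forall>\<^sub>F n in sequentially. sym_dist d (centre (code p (n + length \<sigma>))) x
        \<le> radius (code p (n + length \<sigma>))"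
      using near by (simp add: less_imp_le)
    show "(\<lambda>n. radius (code p (n + length \<sigma>))) \<longlonglongrightarrow> 0"
      using LIMSEQ_ignore_initial_segment[OF radius_code_tendsto] .
  qed simp
  then have "limit p = x"
    by (rule limit_eqI[OF \<open>x \<in> X\<close> LIMSEQ_offset])
  with p show "x \<in> limit ` cylinder \<sigma>" by blast
qed

section \<open>Effective openness and computability of the limit map\<close>

lemma computable_state: "computable (\<lambda>n. foldl push 0 (list_decode n))"
  by (rule computable_foldl[OF computable2_push])

lemma effectively_open_limit: "effectively_open_from_baire ball limit"
proof -
  \<comment> \<open>The number \<open>b\<close> ranges over the balls reached from the prefix coded
    by \<open>e\<close> with one further input \<open>n\<close>.\<close>
  let ?R = "\<lambda>e b n. Suc b = push (foldl push 0 (list_decode e)) n"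
  have "decidable (\<lambda>z. ?R (pfst z) (pfst (psnd z)) (psnd (psnd z)))"
    by (intro computable_intros computable2_comp[OF computable2_push]
        computable_comp[OF computable_state])
  then obtain g where g: "computable g" "\<And>e. W (g e) = {b. \<exists>n. ?R e b n}"
    using uniformly_ce_projection[of ?R] by blast
  have "limit ` cylinder (list_decode e) = (\<Union>b\<in>W (g e). ball b)" for e
    unfolding limit_image_cylinder g(2) by (rule target_eq_Union_push)
  with g(1) have "uniformly_effective_open ball (\<lambda>e. limit ` cylinder (list_decode e))"
    unfolding uniformly_effective_open_def by blast
  then show ?thesis
    unfolding effectively_open_from_baire_def
    by (intro exI[of _ "\<lambda>e. limit ` cylinder (list_decode e)"]) simp
qed

text \<open>A limit in \<open>ball b\<close> leaves positive slack, and the radius plus the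
  symmetric distance from centre to limit eventually fits into it. Membership is thereby certified
  by a finite prefix of \<open>p\<close>.\<close>

lemma limit_in_ball_iff: "limit p \<in> ball b \<longleftrightarrow> (\<exists>n. inside b (code p n))"
proof
  assume "limit p \<in> ball b"
  then have lt: "d (centre b) (limit p) < radius b" by (simp add: mem_ball)
  have "(\<lambda>n. sym_dist d (centre (code p n)) (limit p) + radius (code p n)) \<longlonglongrightarrow> 0"
    using tendsto_add[OF limit_tendsto radius_code_tendsto] by simp
  then have "\<forall>\<^sub>F n in sequentially. sym_dist d (centre (code p n)) (limit p) + radius (code p n)
      < radius b - d (centre b) (limit p)"
    using lt by (intro order_tendstoD(2)) auto
  then obtain n where n: "sym_dist d (centre (code p n)) (limit p) + radius (code p n)
      < radius b - d (centre b) (limit p)"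
    using eventually_happens'[OF sequentially_bot] by blast
  have "d (centre b) (centre (code p n))
      \<le> d (centre b) (limit p) + sym_dist d (centre (code p n)) (limit p)"
    using d_triangle[of "centre b" "limit p" "centre (code p n)"]
      d_le_sym_dist(2)[of "limit p" "centre (code p n)"] by simp
  with n show "\<exists>n. inside b (code p n)" by (auto simp: inside_def intro!: exI[of _ n])
next
  assume "\<exists>n. inside b (code p n)"
  then show "limit p \<in> ball b" using ball_mono_inside limit_in_ball by blast
qed

lemma computable_limit: "computable_from_baire ball limit"
proof -
  let ?st = "\<lambda>e. foldl push 0 (list_decode e)"
  \<comment> \<open>\<open>e\<close> codes a prefix whose last ball is certified by \<open>k\<close>
    to be formally inside \<open>b\<close>. Positivity excludes the empty prefix, whose state
    \<open>0\<close> would otherwise be read as the ball coded by \<open>0\<close>.\<close>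
  let ?R = "\<lambda>b e k. 0 < ?st e \<and> witness b (?st e - 1) k"
  have "decidable (\<lambda>z. ?R (pfst z) (pfst (psnd z)) (psnd (psnd z)))"
    by (intro computable_intros computable_comp[OF computable_state])
  then obtain g where g: "computable g" "\<And>b. W (g b) = {e. \<exists>k. ?R b e k}"
    using uniformly_ce_projection[of ?R] by blast
  have "limit -` ball b = (\<Union>e\<in>W (g b). baire_basis e)" for b
  proof (intro equalityI subsetI)
    fix p assume "p \<in> limit -` ball b"
    then obtain n where n: "inside b (code p n)" by (auto simp: limit_in_ball_iff)
    let ?\<sigma> = "map p [0..<Suc n]"
    have st: "?st (list_encode ?\<sigma>) = Suc (code p n)"
      by (simp only: list_encode_inverse Suc_code trace_def)
    have "list_encode ?\<sigma> \<in> W (g b)"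
      using n unfolding g(2) mem_Collect_eq st inside_iff_witness by simp
    moreover have "p \<in> baire_basis (list_encode ?\<sigma>)"
      by (auto simp: baire_basis_def cylinder_def simp del: upt_Suc)
    ultimately show "p \<in> (\<Union>e\<in>W (g b). baire_basis e)" by blast
  next
    fix p assume "p \<in> (\<Union>e\<in>W (g b). baire_basis e)"
    then obtain e where e: "0 < ?st e" "inside b (?st e - 1)" "p \<in> cylinder (list_decode e)"
      unfolding g(2) baire_basis_def inside_iff_witness by blast
    have "limit p \<in> target (?st e)"
      using e(3) limit_image_cylinder by blast
    with e(1) have "limit p \<in> ball (?st e - 1)" by (simp add: target_def)
    with ball_mono_inside[OF e(2)] show "p \<in> limit -` ball b" by blast
  qed
  with g(1) show ?thesis
    unfolding computable_from_baire_def uniformly_effective_open_def by blast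
qed

section \<open>The topology generated by the balls\<close>

text \<open>Indexing by formal inclusion keeps the index set c.e. A common point has positive slack
  in each ball, and a ball near it with radius below half of either slack is formally inside
  both.\<close>

lemma ball_Int: "ball b \<inter> ball b' = (\<Union>c\<in>{c. inside b c \<and> inside b' c}. ball c)"
proof (intro equalityI subsetI)
  fix x assume x: "x \<in> ball b \<inter> ball b'"
  then have "x \<in> X" by (simp add: mem_ball)
  have gap: "inside a c"
    if "d (centre a) x + 2 * radius c < radius a" "sym_dist d (centre c) x < radius c"
    for a c
    using that d_triangle[of "centre a" x "centre c"] d_le_sym_dist(2)[of x "centre c"] \<open>x \<in> X\<close>
    by (simp add: inside_def)
  define \<delta> where "\<delta> = min ((radius b - d (centre b) x) / 2) ((radius b' - d (centre b') x) / 2)"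
  have "0 < \<delta>" using x by (simp add: \<delta>_def mem_ball)
  then obtain c where c: "sym_dist d (centre c) x < radius c" "radius c < \<delta>"
    using small_ball_near[OF \<open>x \<in> X\<close>] by blast
  then have "inside b c" "inside b' c"
    by (auto intro!: gap simp: \<delta>_def field_simps)
  moreover have "x \<in> ball c"
    using c(1) d_le_sym_dist(1)[of "centre c" x] \<open>x \<in> X\<close> by (simp add: mem_ball)
  ultimately show "x \<in> (\<Union>c\<in>{c. inside b c \<and> inside b' c}. ball c)" by blast
qed (use ball_mono_inside in blast)

lemma computable_ball_Int: "\<exists>f. computable2 f \<and> (\<forall>i j. ball i \<inter> ball j = (\<Union>k\<in>W (f i j). ball k))"
proof -
  \<comment> \<open>The parameter \<open>e\<close> codes the two given balls, and the single search
    variable \<open>n\<close> codes both witnesses.\<close>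
  let ?R = "\<lambda>e c n. witness (pfst e) c (pfst n) \<and> witness (psnd e) c (psnd n)"
  have "decidable (\<lambda>z. ?R (pfst z) (pfst (psnd z)) (psnd (psnd z)))"
    by (intro computable_intros)
  then obtain g where g: "computable g" "\<And>e. W (g e) = {c. \<exists>n. ?R e c n}"
    using uniformly_ce_projection[of ?R] by blast
  have "W (g (prod_encode (i, j))) = {c. inside i c \<and> inside j c}" for i j
    unfolding g(2) inside_iff_witness
    by (auto intro: exI[of _ "prod_encode (_, _)"])
  moreover have "computable2 (\<lambda>i j. g (prod_encode (i, j)))"
    using g(1) by (simp add: computable2_iff)
  ultimately show ?thesis
    using ball_Int by (intro exI[of _ "\<lambda>i j. g (prod_encode (i, j))"]) simp
qed

lemma topspace_qm_topology: "topspace (qm_topology X d s) = X"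
proof -
  have "X \<subseteq> \<Union> (range ball)"
  proof
    fix x assume "x \<in> X"
    then obtain c where "sym_dist d (centre c) x < radius c"
      using small_ball_near[of x 1] by auto
    with \<open>x \<in> X\<close> d_le_sym_dist(1)[of "centre c" x] show "x \<in> \<Union> (range ball)"
      by (auto simp: mem_ball intro!: exI[of _ c])
  qed
  then show ?thesis by (auto simp: qm_topology_def mem_ball)
qed

lemma openin_ball: "openin (qm_topology X d s) (ball b)"
  unfolding qm_topology_def by (rule topology_generated_by_Basis) simp

lemma openin_qm_topology:
  "openin (qm_topology X d s) = arbitrary union_of (\<lambda>U. U \<in> range ball)"
  unfolding openin_topology_base_unique
proof (intro conjI allI impI)
  fix V assume "V \<in> range ball"
  then show "openin (qm_topology X d s) V" using openin_ball by blast
next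
  fix U x assume "openin (qm_topology X d s) U \<and> x \<in> U"
  then have "generate_topology_on (range ball) U" "x \<in> U"
    by (simp_all add: qm_topology_def openin_topology_generated_by_iff)
  \<comment> \<open>In this induction over the generation of open sets, only binary intersections
    call for an argument, supplied by \<open>ball_Int\<close>.\<close>
  then have "\<exists>b. x \<in> ball b \<and> ball b \<subseteq> U"
  proof (induction arbitrary: x)
    case (Int U V)
    then obtain b c where "x \<in> ball b" "ball b \<subseteq> U" "x \<in> ball c" "ball c \<subseteq> V" by blast
    moreover from this have "x \<in> (\<Union>e\<in>{e. inside b e \<and> inside c e}. ball e)"
      unfolding ball_Int[symmetric] by blast
    ultimately show ?case using ball_mono_inside by blast
  qed blast+
  then show "\<exists>V. V \<in> range ball \<and> x \<in> V \<and> V \<subseteq> U" by blast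
qed

text \<open>A ball near \<open>x\<close> of radius below half of \<open>d x y\<close> misses
  \<open>y\<close>, because \<open>d x y\<close> is at most the distance from \<open>x\<close> to
  the centre plus that from the centre to \<open>y\<close>.\<close>

lemma ball_separates:
  assumes "x \<in> X" "y \<in> X" "0 < d x y"
  shows "\<exists>b. x \<in> ball b \<and> y \<notin> ball b"
proof -
  obtain c where c: "sym_dist d (centre c) x < radius c" "radius c < d x y / 2"
    using small_ball_near[OF assms(1)] assms(3) half_gt_zero by blast
  have "d x y \<le> sym_dist d (centre c) x + d (centre c) y"
    using d_triangle[of x "centre c" y] d_le_sym_dist(2)[of x "centre c"] assms(1,2) by simp
  with c d_le_sym_dist(1)[of "centre c" x] assms(1,2) have "x \<in> ball c" "y \<notin> ball c"
    by (auto simp: mem_ball)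
  then show ?thesis by blast
qed

lemma t0_space_qm_topology: "t0_space (qm_topology X d s)"
  unfolding t0_space_def topspace_qm_topology
proof (intro ballI impI)
  fix x y assume "x \<in> X" "y \<in> X" "x \<noteq> y"
  \<comment> \<open>Which distance is positive is unknown, so the separating ball may contain either
    point, as the T0 axiom allows.\<close>
  then have "0 < d x y \<or> 0 < d y x"
    using eq_iff_d_zero d_nonneg by (metis order_le_less)
  then have "\<exists>b. (x \<in> ball b) \<noteq> (y \<in> ball b)"
    using ball_separates \<open>x \<in> X\<close> \<open>y \<in> X\<close> by metis
  then show "\<exists>U. openin (qm_topology X d s) U \<and> (x \<notin> U) = (y \<in> U)"
    using openin_ball by blast
qed

lemma effective_quasi_Polish: "effective_quasi_Polish (qm_topology X d s) ball"
proof -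
  \<comment> \<open>Surjectivity is the case of the empty prefix, whose state \<open>0\<close> has
    the whole space as target.\<close>
  have "limit ` cylinder [] = X" by (simp add: limit_image_cylinder target_def)
  then have "range limit = X" by (simp add: cylinder_def)
  then show ?thesis
    unfolding effective_quasi_Polish_def effective_topological_space_def topspace_qm_topology
    using t0_space_qm_topology openin_qm_topology computable_ball_Int computable_limit
      effectively_open_limit by blast
qed

end

theorem theorem5:
  fixes X :: "'a set" and d :: "'a \<Rightarrow> 'a \<Rightarrow> real" and s :: "nat \<Rightarrow> 'a"
  assumes "right_ce_quasi_metric_space X d s"
    and "smyth_complete X d"
  shows "effective_quasi_Polish (qm_topology X d s) (qm_basis X d s)"
proof -
  have space: "quasi_metric_on X d" "range s \<subseteq> X"
    "\<And>x \<epsilon>. x \<in> X \<Longrightarrow> 0 < \<epsilon> \<Longrightarrow> \<exists>i. sym_dist d (s i) x < \<epsilon>"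
    "uniformly_right_ce (\<lambda>i j. d (s i) (s j))"
    using assms(1) by (simp_all add: right_ce_quasi_metric_space_def)
  then obtain q where "computable3 q"
    and q: "\<forall>i j. bdd_below (range (\<lambda>k. real_of_rat (rat_num (q i j k)))) \<and>
      d (s i) (s j) = (INF k. real_of_rat (rat_num (q i j k)))"
    unfolding uniformly_right_ce_def by (elim exE conjE)
  interpret complete_right_ce X d s q
    by (rule complete_right_ce.intro[OF space(1-3) \<open>computable3 q\<close> _ _ assms(2)])
      (use q in simp_all)
  show ?thesis by (rule effective_quasi_Polish)
qed

end
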